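(* Let $K$ be an infinite field, let $P=K[x_1,\dots,x_n]$, and let $\mathcal{L}$ be a sufficiently generic distraction matrix with entries in $P_1$. Then for every strongly stable monomial ideal $I$ in $P$, $$\mathrm{in}_{\mathrm{drl}}\big(D_{\mathcal{L}}(I)\big)=I .$$
   Context: $P=K[x_1,\dots,x_n]$ is standard graded, $P_d$ is its degree-$d$ component, and $\mathbb{T}^n$ is the monoid of power products in $x_1,\dots,x_n$. A distraction matrix is an infinite matrix $\mathcal{L}=(L_{ij}\mid i=1,\dots,n,\ j\ge 1)$ with $L_{ij}\in P_1$ such that (a) $\langle L_{1j_1},\dots,L_{nj_n}\rangle=P_1$ ($K$-linear span) for all $j_1,\dots,j_n\ge 1$; (b) there is $N$ with $L_{ij}=L_{iN}$ for all $i$ and all $j>N$. It is sufficiently generic if $\langle L_{1j_1},\dots,L_{kj_k},x_{k+1},\dots,x_n\rangle=P_1$ for every $k=1,\dots,n$ and all $j_1,\dots,j_k\ge 1$. For $t=x_1^{\alpha_1}\cdots x_n^{\alpha_n}$ put $D_{\mathcal{L}}(t)=\prod_{i=1}^n\prod_{j=1}^{\alpha_i}L_{ij}$ and extend $D_{\mathcal{L}}$ to $P$ by $K$-linearity; for a $K$-subspace $V\subseteq P$, $D_{\mathcal{L}}(V)$ denotes its image. For a monomial ideal $I$, $D_{\mathcal{L}}(I)$ is a homogeneous ideal. A monomial ideal $I$ is strongly stable if for every power product $t\in I$, every $j$ with $x_j\mid t$ and every $i\le j$, one has $x_i\,t/x_j\in I$. $\mathrm{in}_{\mathrm{drl}}(I)$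 is the initial (leading term) ideal with respect to DegRevLex with $x_1>\dots>x_n$: $t>t'$ iff $\deg t>\deg t'$, or the degrees are equal and the last nonzero entry of the difference of exponent vectors (of $t$ minus that of $t'$) is negative. *)

theory Defs
  imports Complex_Main "HOL-Library.Poly_Mapping"
begin

text \<open>
  The indeterminates are indexed by a finite linearly ordered type \<open>'n\<close>; its elements in
  increasing order are the indices \<open>1, \<dots>, n\<close>, so \<open>n\<close> is the cardinality of \<open>'n\<close>.
  A power product is its exponent vector \<open>'n \<Rightarrow>\<^sub>0 nat\<close>, written additively.
\<close>

type_synonym 'n pp = "'n \<Rightarrow>\<^sub>0 nat"
type_synonym ('n, 'k) mpoly = "('n \<Rightarrow>\<^sub>0 nat) \<Rightarrow>\<^sub>0 'k"

definition monomial :: "'n pp \<Rightarrow> ('n, 'k::zero_neq_one) mpoly"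
  where "monomial t = Poly_Mapping.single t 1"

definition indet :: "'n \<Rightarrow> ('n, 'k::zero_neq_one) mpoly"
  where "indet i = monomial (Poly_Mapping.single i 1)"

definition kscale :: "'k::field \<Rightarrow> ('n, 'k) mpoly \<Rightarrow> ('n, 'k) mpoly"
  where "kscale c p = Poly_Mapping.single 0 c * p"

global_interpretation kspace: vector_space "kscale :: 'k::field \<Rightarrow> ('n, 'k) mpoly \<Rightarrow> ('n, 'k) mpoly"
  by unfold_locales
    (simp_all add: kscale_def distrib_left distrib_right single_add mult_single flip: mult.assoc)

text \<open>
  Every commutative ring as a module over itself: \<open>ideal.span\<close> is the ideal generated by a set.
\<close>

global_interpretation ideal: module "(*) :: 'a::comm_ring_1 \<Rightarrow> 'a \<Rightarrow> 'a"
  by unfold_locales (simp_all add: algebra_simps)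

definition deg_pp :: "'n::finite pp \<Rightarrow> nat"
  where "deg_pp t = (\<Sum>i\<in>UNIV. Poly_Mapping.lookup t i)"

definition homog_comp :: "nat \<Rightarrow> ('n::finite, 'k::zero) mpoly set"
  where "homog_comp d = {p. \<forall>t\<in>Poly_Mapping.keys p. deg_pp t = d}"

text \<open>The columns of \<open>L\<close> are indexed by \<open>j \<ge> 1\<close>; the value \<open>L i 0\<close> is never used.\<close>

definition distraction_matrix :: "('n::finite \<Rightarrow> nat \<Rightarrow> ('n, 'k::field) mpoly) \<Rightarrow> bool"
  where "distraction_matrix L \<longleftrightarrow>
    (\<forall>i. \<forall>j\<ge>1. L i j \<in> homog_comp 1) \<and>
    (\<forall>j. (\<forall>i. j i \<ge> 1) \<longrightarrow> kspace.span (range (\<lambda>i. L i (j i))) = homog_comp 1) \<and>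
    (\<exists>N\<ge>1. \<forall>i. \<forall>j>N. L i j = L i N)"

definition sufficiently_generic ::
    "('n::{finite,linorder} \<Rightarrow> nat \<Rightarrow> ('n, 'k::field) mpoly) \<Rightarrow> bool"
  where "sufficiently_generic L \<longleftrightarrow>
    (\<forall>k j. (\<forall>i\<le>k. j i \<ge> 1) \<longrightarrow>
      kspace.span ((\<lambda>i. L i (j i)) ` {..k} \<union> indet ` {k<..}) = homog_comp 1)"

definition distract_pp ::
    "('n::finite \<Rightarrow> nat \<Rightarrow> ('n, 'k::field) mpoly) \<Rightarrow> 'n pp \<Rightarrow> ('n, 'k) mpoly"
  where "distract_pp L t = (\<Prod>i\<in>UNIV. \<Prod>j = 1..Poly_Mapping.lookup t i. L i j)"

definition distraction ::
    "('n::finite \<Rightarrow> nat \<Rightarrow> ('n, 'k::field) mpoly) \<Rightarrow> ('n, 'k) mpoly \<Rightarrow> ('n, 'k) mpoly"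
  where "distraction L p =
    (\<Sum>t\<in>Poly_Mapping.keys p. kscale (Poly_Mapping.lookup p t) (distract_pp L t))"

definition monomial_ideal :: "('n, 'k::field) mpoly set \<Rightarrow> bool"
  where "monomial_ideal I \<longleftrightarrow> (\<exists>T. I = ideal.span (monomial ` T))"

text \<open>The power product \<open>x\<^sub>i t / x\<^sub>j\<close> has exponent vector \<open>t - e\<^sub>j + e\<^sub>i\<close>.\<close>

definition strongly_stable :: "('n::linorder, 'k::field) mpoly set \<Rightarrow> bool"
  where "strongly_stable I \<longleftrightarrow> monomial_ideal I \<and>
    (\<forall>t i j. monomial t \<in> I \<and> Poly_Mapping.lookup t j > 0 \<and> i \<le> j \<longrightarrow>
      monomial (t - Poly_Mapping.single j 1 + Poly_Mapping.single i 1) \<in> I)"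

text \<open>\<open>drl_less s t\<close> means \<open>s < t\<close>; the index \<open>k\<close> is that of the last nonzero entry of \<open>t - s\<close>.\<close>

definition drl_less :: "'n::{finite,linorder} pp \<Rightarrow> 'n pp \<Rightarrow> bool"
  where "drl_less s t \<longleftrightarrow> deg_pp s < deg_pp t \<or>
    deg_pp s = deg_pp t \<and>
    (\<exists>k. Poly_Mapping.lookup t k < Poly_Mapping.lookup s k \<and>
      (\<forall>i>k. Poly_Mapping.lookup t i = Poly_Mapping.lookup s i))"

definition is_leading_pp :: "('n::{finite,linorder}, 'k::zero) mpoly \<Rightarrow> 'n pp \<Rightarrow> bool"
  where "is_leading_pp p t \<longleftrightarrow>
    t \<in> Poly_Mapping.keys p \<and>
    (\<forall>s\<in>Poly_Mapping.keys p. s \<noteq> t \<longrightarrow> drl_less s t)"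

definition in_drl :: "('n::{finite,linorder}, 'k::field) mpoly set \<Rightarrow> ('n, 'k) mpoly set"
  where "in_drl J = ideal.span {monomial t | t. \<exists>f\<in>J. is_leading_pp f t}"

lemma drl_less_irrefl: "\<not> drl_less t t"
  by (auto simp: drl_less_def)

lemma drl_less_trans:
  assumes "drl_less r s" and "drl_less s t"
  shows "drl_less r t"
proof (cases "deg_pp r = deg_pp s \<and> deg_pp s = deg_pp t")
  case True
  obtain k where k: "Poly_Mapping.lookup s k < Poly_Mapping.lookup r k"
      "\<forall>i>k. Poly_Mapping.lookup s i = Poly_Mapping.lookup r i"
    using assms(1) True by (auto simp: drl_less_def)
  obtain l where l: "Poly_Mapping.lookup t l < Poly_Mapping.lookup s l"
      "\<forall>i>l. Poly_Mapping.lookup t i = Poly_Mapping.lookup s i"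
    using assms(2) True by (auto simp: drl_less_def)
  have "k < l \<or> k = l \<or> l < k" by auto
  then have "Poly_Mapping.lookup t (max k l) < Poly_Mapping.lookup r (max k l)"
    using k l by (elim disjE) (simp_all add: max_def)
  moreover have "\<forall>i>max k l. Poly_Mapping.lookup t i = Poly_Mapping.lookup r i"
    using k l by auto
  ultimately show ?thesis using True by (auto simp: drl_less_def)
qed (use assms in \<open>auto simp: drl_less_def\<close>)

lemma drl_less_total:
  assumes "s \<noteq> t"
  shows "drl_less s t \<or> drl_less t s"
proof -
  let ?D = "{i. Poly_Mapping.lookup s i \<noteq> Poly_Mapping.lookup t i}"
  have ne: "?D \<noteq> {}" using assms by (auto intro: poly_mapping_eqI)
  define k where "k = Max ?D"
  have "k \<in> ?D" using ne unfolding k_def by (intro Max_in) auto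
  moreover have "\<forall>i>k. Poly_Mapping.lookup s i = Poly_Mapping.lookup t i"
  proof (intro allI impI)
    fix i assume "i > k"
    moreover have "i \<le> k" if "i \<in> ?D"
      unfolding k_def using that by (intro Max_ge) simp_all
    ultimately have "i \<notin> ?D" by (meson leD)
    then show "Poly_Mapping.lookup s i = Poly_Mapping.lookup t i" by simp
  qed
  moreover from calculation
  have "Poly_Mapping.lookup s k < Poly_Mapping.lookup t k \<or>
      Poly_Mapping.lookup t k < Poly_Mapping.lookup s k"
    by auto
  ultimately show ?thesis
    unfolding drl_less_def by (metis linorder_neqE_nat)
qed

lemma ex1_leading_pp:
  assumes "p \<noteq> 0"
  shows "\<exists>!t. is_leading_pp p t"
proof -
  have max: "\<exists>t\<in>S. \<forall>s\<in>S. s \<noteq> t \<longrightarrow> drl_less s t"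
    if "finite S" "S \<noteq> {}" for S :: "'a pp set"
    using that
  proof (induction S rule: finite_ne_induct)
    case (insert x S)
    then obtain t where t: "t \<in> S" "\<forall>s\<in>S. s \<noteq> t \<longrightarrow> drl_less s t" by blast
    show ?case
    proof (cases "drl_less t x")
      case True
      then have "\<forall>s\<in>S. drl_less s x" using t(2) drl_less_trans by metis
      then show ?thesis by simp
    next
      case False
      then have "x \<noteq> t \<longrightarrow> drl_less x t" using drl_less_total by blast
      then show ?thesis using t by (intro bexI[of _ t]) simp_all
    qed
  qed simp
  have "\<exists>t\<in>Poly_Mapping.keys p. \<forall>s\<in>Poly_Mapping.keys p. s \<noteq> t \<longrightarrow> drl_less s t"
    using assms by (intro max) simp_all
  then obtain t where t: "is_leading_pp p t"
    unfolding is_leading_pp_def by blast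
  moreover have "s = t" if "is_leading_pp p s" for s
  proof (rule ccontr)
    assume "s \<noteq> t"
    then have "drl_less s t" "drl_less t s"
      using t that unfolding is_leading_pp_def by simp_all
    then show False using drl_less_trans[of s t s] drl_less_irrefl[of s] by simp
  qed
  ultimately show ?thesis by blast
qed

end

theory Submission
  imports Defs "HOL-Library.FuncSet"
begin

text \<open>
  Write \<open>D\<close> for the distraction and \<open>e\<^sub>i\<close> for the exponent vector of \<open>x\<^sub>i\<close>. By induction on the
  degree, every power product \<open>t\<close> is the leading term of a combination of polynomials \<open>D(s)\<close> with
  \<open>s\<close> obtained from \<open>t\<close> by strongly stable moves. If \<open>f\<close> is such a combination for \<open>t\<close>, and no
  indeterminate beyond \<open>x\<^sub>k\<close> divides \<open>x\<^sub>k t\<close>, then \<open>x\<^sub>k f\<close> has the leading term \<open>x\<^sub>k t\<close>. For each \<open>s\<close>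
  genericity writes \<open>x\<^sub>k\<close> as a combination of the \<open>L\<^sub>i\<^sub>j\<close> with \<open>i \<le> k\<close>, \<open>j = s\<^sub>i + 1\<close> and the \<open>x\<^sub>i\<close> with
  \<open>i > k\<close>. As \<open>L\<^sub>i\<^sub>j D(s) = D(s + e\<^sub>i)\<close>, the first kind of terms is of the required form, while the
  second kind only contributes power products below \<open>x\<^sub>k t\<close> and can be dropped. Hence every power
  product of \<open>I\<close> is a leading term of \<open>D(I)\<close>. There are no others: the power products of \<open>I\<close> up to
  a given degree already account for the dimension of the span of their distractions.
\<close>

text \<open>As a rewrite rule this is associativity of multiplication against its usual orientation.\<close>

declare ideal.scale_scale [simp del]

section \<open>Degrees, \<open>K\<close>-spans and homogeneous components\<close>

lemma deg_pp_add: "deg_pp (s + t) = deg_pp s + deg_pp t"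
  by (simp add: deg_pp_def lookup_add sum.distrib)

lemma deg_pp_single: "deg_pp (Poly_Mapping.single i m) = m"
  by (simp add: deg_pp_def lookup_single when_def)

text \<open>Every exponent is bounded by the degree. The finiteness is what allows dimensions to be
  compared later on.\<close>

lemma finite_deg_pp_le: "finite {t :: 'n::finite pp. deg_pp t \<le> d}"
proof -
  have "Poly_Mapping.lookup t i \<le> deg_pp t" for t :: "'n pp" and i
    unfolding deg_pp_def by (rule member_le_sum) simp_all
  then have "Poly_Mapping.lookup ` {t :: 'n pp. deg_pp t \<le> d} \<subseteq> Pi\<^sub>E UNIV (\<lambda>_. {..d})"
    by (auto simp: PiE_def extensional_def intro: le_trans)
  moreover have "finite (Pi\<^sub>E (UNIV :: 'n set) (\<lambda>_. {..d}))"
    by (rule finite_PiE) simp_all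
  ultimately show ?thesis
    by (metis (no_types) finite_imageD finite_subset inj_on_subset inj_onI
        poly_mapping.lookup_inject subset_UNIV)
qed

lemma kspace_span_mult:
  assumes "x \<in> kspace.span S"
  shows "a * x \<in> kspace.span ((*) a ` S)"
  using assms
proof (induction rule: kspace.span_induct_alt)
  case base
  then show ?case by (simp add: kspace.span_zero)
next
  case (step c x y)
  have "a * (kscale c x + y) = kscale c (a * x) + a * y"
    by (simp add: kscale_def algebra_simps)
  then show ?case
    using step by (simp add: kspace.span_add kspace.span_scale kspace.span_base)
qed

lemma lookup_kscale: "Poly_Mapping.lookup (kscale c p) t = c * Poly_Mapping.lookup p t"
  by (simp add: kscale_def lookup_mult lookup_single mult_when when_mult)

lemma kspace_subspace_keys:
  "kspace.subspace {p :: ('n, 'k::field) mpoly. \<forall>t\<in>Poly_Mapping.keys p. Q t}"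
proof (rule kspace.subspaceI)
  fix x y :: "('n, 'k) mpoly" and c
  assume x: "x \<in> {p. \<forall>t\<in>Poly_Mapping.keys p. Q t}"
    and y: "y \<in> {p. \<forall>t\<in>Poly_Mapping.keys p. Q t}"
  show "x + y \<in> {p. \<forall>t\<in>Poly_Mapping.keys p. Q t}"
    using x y keys_add[of x y] by blast
  show "kscale c x \<in> {p. \<forall>t\<in>Poly_Mapping.keys p. Q t}"
    using x by (auto simp: in_keys_iff lookup_kscale)
qed simp

lemma homog_comp_mult:
  assumes "p \<in> homog_comp d" "q \<in> homog_comp e"
  shows "p * q \<in> homog_comp (d + e)"
  using assms keys_mult[of p q] by (fastforce simp: homog_comp_def deg_pp_add)

lemma homog_comp_one: "1 \<in> homog_comp 0"
  by (simp add: homog_comp_def deg_pp_def)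

lemma homog_comp_prod:
  assumes "finite A" "\<And>i. i \<in> A \<Longrightarrow> f i \<in> homog_comp (d i)"
  shows "(\<Prod>i\<in>A. f i) \<in> homog_comp (\<Sum>i\<in>A. d i)"
  using assms
  by (induction A rule: finite_induct) (simp_all add: homog_comp_one homog_comp_mult)

section \<open>Distractions of single power products\<close>

lemma distract_pp_homog:
  assumes "distraction_matrix L"
  shows "distract_pp L t \<in> homog_comp (deg_pp t)"
proof -
  have "(\<Prod>j = 1..Poly_Mapping.lookup t i. L i j)
      \<in> homog_comp (\<Sum>j = 1..Poly_Mapping.lookup t i. 1)" for i
    using assms by (intro homog_comp_prod) (auto simp: distraction_matrix_def)
  then have "(\<Prod>j = 1..Poly_Mapping.lookup t i. L i j) \<in> homog_comp (Poly_Mapping.lookup t i)" for i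
    by simp
  then show ?thesis
    unfolding distract_pp_def deg_pp_def by (intro homog_comp_prod) simp_all
qed

lemma distract_pp_zero: "distract_pp L 0 = 1"
  by (simp add: distract_pp_def)

lemma distract_pp_add_single:
  "distract_pp L (t + Poly_Mapping.single i 1) =
    distract_pp L t * L i (Suc (Poly_Mapping.lookup t i))"
proof -
  have "distract_pp L (t + Poly_Mapping.single i 1) =
      (\<Prod>j = 1..Suc (Poly_Mapping.lookup t i). L i j) *
      (\<Prod>l\<in>UNIV - {i}. \<Prod>j = 1..Poly_Mapping.lookup t l. L l j)"
    unfolding distract_pp_def
    by (subst prod.remove[of _ i])
      (auto simp: lookup_add lookup_single when_def intro!: prod.cong)
  also have "\<dots> = distract_pp L t * L i (Suc (Poly_Mapping.lookup t i))"
    unfolding distract_pp_def by (subst prod.remove[of UNIV i]) (simp_all add: mult_ac)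
  finally show ?thesis .
qed

lemma indet_homog: "indet i \<in> homog_comp 1"
  by (simp add: indet_def monomial_def homog_comp_def deg_pp_single)

lemma distract_pp_times_indet:
  assumes "sufficiently_generic L"
  shows "distract_pp L s * indet k \<in> kspace.span
    ((\<lambda>i. distract_pp L (s + Poly_Mapping.single i 1)) ` {..k} \<union>
     (\<lambda>i. distract_pp L s * indet i) ` {k<..})"
proof -
  have "indet k \<in> kspace.span
      ((\<lambda>i. L i (Suc (Poly_Mapping.lookup s i))) ` {..k} \<union> indet ` {k<..})"
  proof -
    have "kspace.span
        ((\<lambda>i. L i (Suc (Poly_Mapping.lookup s i))) ` {..k} \<union> indet ` {k<..}) = homog_comp 1"
      \<comment> \<open>Column \<open>s_i + 1\<close> is taken in row \<open>i\<close> because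
        \<open>L i (s_i + 1)\<close> is exactly the next factor: multiplying
        \<open>distract_pp L s\<close> by it gives a distraction again.\<close>
      using assms[unfolded sufficiently_generic_def, rule_format,
          of k "\<lambda>i. Suc (Poly_Mapping.lookup s i)"] by simp
    then show ?thesis using indet_homog by simp
  qed
  from kspace_span_mult[OF this, of "distract_pp L s"] show ?thesis
    by (simp add: image_Un image_image distract_pp_add_single del: One_nat_def)
qed

section \<open>Leading power products and DegRevLex\<close>

lemma lookup_single_mult:
  fixes f :: "('n, 'k::field) mpoly"
  shows "Poly_Mapping.lookup (Poly_Mapping.single u 1 * f) (u + t) = Poly_Mapping.lookup f t"
  by (simp add: lookup_mult lookup_single when_mult)

lemma drl_less_add:
  assumes "drl_less s t"
  shows "drl_less (u + s) (u + t)"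
  using assms by (auto simp: drl_less_def deg_pp_add lookup_add)

lemma is_leading_pp_monomial_mult:
  fixes f :: "('n::{finite,linorder}, 'k::field) mpoly"
  assumes "is_leading_pp f t"
  shows "is_leading_pp (monomial u * f) (u + t)"
proof -
  have "u + t \<in> Poly_Mapping.keys (monomial u * f)"
    using assms by (simp add: is_leading_pp_def monomial_def in_keys_iff lookup_single_mult)
  moreover have "drl_less s (u + t)" if s: "s \<in> Poly_Mapping.keys (monomial u * f)" "s \<noteq> u + t" for s
  proof -
    obtain r where "r \<in> Poly_Mapping.keys f" "s = u + r"
      using s(1) keys_mult[of "monomial u" f] by (fastforce simp: monomial_def)
    then show ?thesis
      using assms s(2) by (auto simp: is_leading_pp_def intro: drl_less_add)
  qed
  ultimately show ?thesis by (simp add: is_leading_pp_def)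
qed

lemma is_leading_pp_diff:
  fixes f :: "('n::{finite,linorder}, 'k::field) mpoly"
  assumes "is_leading_pp f t" "\<And>s. s \<in> Poly_Mapping.keys q \<Longrightarrow> drl_less s t"
  shows "is_leading_pp (f - q) t"
proof -
  have "t \<notin> Poly_Mapping.keys q" using assms(2) drl_less_irrefl by blast
  then show ?thesis
    using assms keys_diff[of f q]
    by (auto simp: is_leading_pp_def in_keys_iff lookup_minus)
qed

text \<open>The last index at which \<open>s\<close> and \<open>t\<close> differ is at least
  \<open>i\<close>, hence beyond \<open>k\<close>. There \<open>t\<close> has exponent 0, so
  \<open>s\<close> has the larger exponent and is the smaller power product.\<close>

lemma drl_less_if_later_indet:
  assumes "deg_pp s = deg_pp t" and "k < i" "Poly_Mapping.lookup s i > 0"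
    and "\<And>j. k < j \<Longrightarrow> Poly_Mapping.lookup t j = 0"
  shows "drl_less s t"
proof (rule ccontr)
  assume "\<not> drl_less s t"
  moreover have "s \<noteq> t" using assms(2-4) by force
  ultimately have "drl_less t s" using drl_less_total by blast
  then obtain l where l: "Poly_Mapping.lookup s l < Poly_Mapping.lookup t l"
      "\<forall>j>l. Poly_Mapping.lookup s j = Poly_Mapping.lookup t j"
    using assms(1) by (auto simp: drl_less_def)
  then have "l \<le> k" using assms(4)[of l] by fastforce
  then show False using l(2) assms(2-4) by fastforce
qed

section \<open>Leading terms from strongly stable moves\<close>

text \<open>This contains all \<open>s\<close> obtained from \<open>t\<close> by strongly stable moves. Quantifying over the
  translates by \<open>r\<close> makes it compatible with multiplying \<open>t\<close> by an indeterminate, even if \<open>t \<notin> I\<close>.\<close>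

definition borel_above :: "('n::{finite,linorder}, 'k::field) mpoly set \<Rightarrow> 'n pp \<Rightarrow> 'n pp set"
  where "borel_above I t = {s. deg_pp s = deg_pp t \<and>
    (\<forall>r. monomial (t + r) \<in> I \<longrightarrow> monomial (s + r) \<in> I)}"

text \<open>The defining property for \<open>s\<close> is used with the translate
  \<open>e_k + r\<close>. The monomial obtained is divisible by \<open>x_k\<close>, so one strongly
  stable move turns \<open>x_k\<close> into \<open>x_i\<close>.\<close>

lemma borel_above_step:
  assumes "strongly_stable I" "s \<in> borel_above I t" "i \<le> k"
  shows "s + Poly_Mapping.single i 1 \<in> borel_above I (t + Poly_Mapping.single k 1)"
proof -
  have "monomial (s + Poly_Mapping.single i 1 + r) \<in> I"
    if "monomial (t + Poly_Mapping.single k 1 + r) \<in> I" for r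
  proof -
    let ?u = "s + r + Poly_Mapping.single k 1"
    have "monomial (t + (Poly_Mapping.single k 1 + r)) \<in> I"
      using that by (simp add: add.assoc)
    then have "monomial (s + (Poly_Mapping.single k 1 + r)) \<in> I"
      using assms(2) unfolding borel_above_def by blast
    then have "monomial ?u \<in> I" by (simp add: ac_simps)
    moreover have "Poly_Mapping.lookup ?u k > 0" by (simp add: lookup_add)
    ultimately have "monomial (?u - Poly_Mapping.single k 1 + Poly_Mapping.single i 1) \<in> I"
      using assms(1,3) unfolding strongly_stable_def by blast
    moreover have "?u - Poly_Mapping.single k 1 = s + r" by simp
    ultimately show ?thesis by (simp only: ac_simps)
  qed
  then show ?thesis
    using assms(2) by (simp add: borel_above_def deg_pp_add deg_pp_single)
qed

text \<open>Membership of \<open>t\<close> in \<open>I\<close> is not assumed, since the induction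
  passes to the divisor \<open>t / x_k\<close>, which may lie outside \<open>I\<close>.\<close>

lemma borel_above_leading:
  fixes L :: "'n::{finite,linorder} \<Rightarrow> nat \<Rightarrow> ('n, 'k::field) mpoly"
  assumes L: "distraction_matrix L" "sufficiently_generic L" and I: "strongly_stable I"
  shows "\<exists>f \<in> kspace.span (distract_pp L ` borel_above I t). is_leading_pp f t"
proof (induction "deg_pp t" arbitrary: t)
  case 0
  then have "t = 0" by (auto simp: deg_pp_def intro: poly_mapping_eqI)
  moreover have "0 \<in> borel_above I 0" by (simp add: borel_above_def)
  then have "1 \<in> kspace.span (distract_pp L ` borel_above I 0)"
    by (metis distract_pp_zero imageI kspace.span_base)
  moreover have "is_leading_pp (1 :: ('n, 'k) mpoly) 0" by (simp add: is_leading_pp_def)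
  ultimately show ?case by blast
next
  case (Suc d)
  \<comment> \<open>Splitting off the last indeterminate that divides \<open>t\<close> ensures that
    products with any \<open>x_i\<close>, \<open>i > k\<close>, of the degree of \<open>t\<close>
    fall below \<open>t\<close>.\<close>
  define k where "k = Max (Poly_Mapping.keys t)"
  have "Poly_Mapping.keys t \<noteq> {}" using Suc(2) by (auto simp: deg_pp_def)
  then have k: "k \<in> Poly_Mapping.keys t" unfolding k_def by (intro Max_in) simp_all
  have k_max: "Poly_Mapping.lookup t j = 0" if "k < j" for j
    using that unfolding k_def by (metis Max_ge finite_keys in_keys_iff leD)
  define u where "u = t - Poly_Mapping.single k 1"
  have t: "t = u + Poly_Mapping.single k 1"
    using k by (intro poly_mapping_eqI)
      (auto simp: u_def lookup_add lookup_minus lookup_single when_def in_keys_iff)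
  have "d = deg_pp u" using Suc(2) by (simp add: t deg_pp_add deg_pp_single)
  then obtain f where f: "f \<in> kspace.span (distract_pp L ` borel_above I u)" "is_leading_pp f u"
    using Suc(1) by blast
  let ?V = "kspace.span (distract_pp L ` borel_above I t)"
  let ?Q = "{p. \<forall>s\<in>Poly_Mapping.keys p. drl_less s t} :: ('n, 'k) mpoly set"
  have Q: "distract_pp L s * indet i \<in> ?Q" if "s \<in> borel_above I u" "k < i" for s i
  proof -
    have "drl_less v t" if v: "v \<in> Poly_Mapping.keys (distract_pp L s * indet i)" for v
    proof -
      have "distract_pp L s * indet i \<in> homog_comp (deg_pp s + 1)"
        by (intro homog_comp_mult distract_pp_homog L indet_homog)
      then have "deg_pp v = deg_pp t"
        using v \<open>s \<in> borel_above I u\<close>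
        by (simp add: homog_comp_def borel_above_def t deg_pp_add deg_pp_single)
      moreover obtain w where "v = w + Poly_Mapping.single i 1"
        using v keys_mult[of "distract_pp L s" "indet i"] by (fastforce simp: indet_def monomial_def)
      then have "Poly_Mapping.lookup v i > 0" by (simp add: lookup_add)
      ultimately show ?thesis
        using \<open>k < i\<close> k_max by (intro drl_less_if_later_indet)
    qed
    then show ?thesis by blast
  qed
  have gen: "distract_pp L s * indet k \<in> kspace.span (distract_pp L ` borel_above I t \<union> ?Q)"
    if s: "s \<in> borel_above I u" for s
  proof -
    have "(\<lambda>i. distract_pp L (s + Poly_Mapping.single i 1)) ` {..k} \<union>
        (\<lambda>i. distract_pp L s * indet i) ` {k<..} \<subseteq> distract_pp L ` borel_above I t \<union> ?Q"
      using borel_above_step[OF I s] Q[OF s] unfolding t by fast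
    then show ?thesis
      using distract_pp_times_indet[OF L(2)] kspace.span_mono by blast
  qed
  have "indet k * f \<in> kspace.span ((*) (indet k) ` distract_pp L ` borel_above I u)"
    by (rule kspace_span_mult[OF f(1)])
  also have "\<dots> \<subseteq> kspace.span (distract_pp L ` borel_above I t \<union> ?Q)"
    by (rule kspace.span_minimal) (use gen in \<open>auto simp: mult.commute[of "indet k"]\<close>)
  finally obtain g q where g: "g \<in> ?V" and q: "q \<in> kspace.span ?Q" and "indet k * f = g + q"
    by (auto simp: kspace.span_Un)
  then have g_eq: "g = indet k * f - q" by simp
  \<comment> \<open>Lying below \<open>t\<close> is a condition on each key separately, so
    \<open>?Q\<close> is a subspace and subtracting \<open>q\<close> cannot disturb the leading term
    of \<open>indet k * f\<close>.\<close>
  have span_Q: "kspace.span ?Q = ?Q"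
    by (simp only: kspace.span_eq_iff kspace_subspace_keys)
  have "q \<in> ?Q" using q unfolding span_Q .
  moreover have "is_leading_pp (indet k * f) t"
    using is_leading_pp_monomial_mult[OF f(2), of "Poly_Mapping.single k 1"]
    by (simp add: indet_def t add.commute)
  ultimately have "is_leading_pp g t"
    unfolding g_eq by (intro is_leading_pp_diff) auto
  then show ?case using g by blast
qed

section \<open>Linear independence from distinct leading terms\<close>

lemma independent_if_leading:
  fixes F :: "'n::{finite,linorder} pp \<Rightarrow> ('n, 'k::field) mpoly"
  assumes "finite S" and F: "\<And>t. t \<in> S \<Longrightarrow> is_leading_pp (F t) t"
  shows "inj_on F S" and "kspace.independent (F ` S)"
proof -
  have leading_unique: "s = t" if "is_leading_pp p s" "is_leading_pp p t"
    for p :: "('n, 'k) mpoly" and s t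
    using that drl_less_trans drl_less_irrefl unfolding is_leading_pp_def by metis
  then show inj: "inj_on F S" using F by (metis inj_onI)
  have zero: "c t = 0" if sum: "(\<Sum>s\<in>S. kscale (c s) (F s)) = 0" and "t \<in> S" for c t
  proof (rule ccontr)
    assume "c t \<noteq> 0"
    \<comment> \<open>The coefficients are packed into a polynomial so that its leading power
      product \<open>m\<close> is the largest index with a nonzero coefficient.\<close>
    define p where "p = (\<Sum>s\<in>S. Poly_Mapping.single s (c s))"
    have p: "Poly_Mapping.lookup p s = (if s \<in> S then c s else 0)" for s
      using \<open>finite S\<close> by (simp add: p_def lookup_sum lookup_single when_def)
    then have "p \<noteq> 0" using \<open>t \<in> S\<close> \<open>c t \<noteq> 0\<close> by (metis lookup_zero)
    then obtain m where m: "is_leading_pp p m" using ex1_leading_pp by blast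
    then have mS: "m \<in> S" and cm: "c m \<noteq> 0"
      by (auto simp: is_leading_pp_def in_keys_iff p split: if_splits)
    have other: "c s * Poly_Mapping.lookup (F s) m = 0" if "s \<in> S - {m}" for s
    proof (rule ccontr)
      assume "c s * Poly_Mapping.lookup (F s) m \<noteq> 0"
      \<comment> \<open>A nonzero \<open>c s\<close> makes \<open>s\<close> a key of
        \<open>p\<close>, hence below \<open>m\<close>; a nonzero coefficient of \<open>F s\<close>
        at \<open>m\<close> puts \<open>m\<close> below the leading power product
        \<open>s\<close>.\<close>
      then have "drl_less s m" "drl_less m s"
        using m F[of s] that by (auto simp: is_leading_pp_def in_keys_iff p)
      then show False using drl_less_trans drl_less_irrefl by blast
    qed
    have "0 = (\<Sum>s\<in>S. c s * Poly_Mapping.lookup (F s) m)"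
      using arg_cong[OF sum, of "\<lambda>p. Poly_Mapping.lookup p m"]
      by (simp add: lookup_sum lookup_kscale)
    also have "\<dots> = c m * Poly_Mapping.lookup (F m) m"
      using \<open>finite S\<close> mS sum.neutral[of "S - {m}"] other
      by (subst sum.remove[of _ m]) (simp_all del: mult_eq_0_iff)
    finally show False using cm F[OF mS] by (simp add: is_leading_pp_def in_keys_iff)
  qed
  show "kspace.independent (F ` S)"
  proof (rule kspace.independent_if_scalars_zero)
    fix c x assume "(\<Sum>y\<in>F ` S. kscale (c y) y) = 0" "x \<in> F ` S"
    then show "c x = 0"
      using zero[of "c \<circ> F"] by (auto simp: sum.reindex[OF inj])
  qed (use \<open>finite S\<close> in simp)
qed

section \<open>Monomial ideals and their images under the distraction\<close>

lemma kscale_in_ideal: "p \<in> ideal.span S \<Longrightarrow> kscale c p \<in> ideal.span S"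
  by (simp add: kscale_def ideal.span_scale)

lemma monomial_in_monomial_ideal:
  fixes I :: "('n, 'k::field) mpoly set"
  assumes "monomial_ideal I" "p \<in> I" "s \<in> Poly_Mapping.keys p"
  shows "monomial s \<in> I"
proof -
  obtain T where T: "I = ideal.span (monomial ` T)"
    using assms(1) unfolding monomial_ideal_def by blast
  have "\<forall>s\<in>Poly_Mapping.keys p. \<exists>u v. u \<in> T \<and> s = v + u"
    using assms(2) unfolding T
  proof (induction rule: ideal.span_induct_alt)
    case base
    then show ?case by simp
  next
    case (step c x y)
    then obtain u where u: "u \<in> T" "x = monomial u" by blast
    have "\<exists>v. s = v + u" if "s \<in> Poly_Mapping.keys (c * x)" for s
      using that keys_mult[of c x] by (fastforce simp: u(2) monomial_def)
    then show ?case using step.IH u(1) keys_add[of "c * x" y] by blast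
  qed
  then obtain u v where "u \<in> T" "s = v + u" using assms(3) by blast
  then have "monomial s = monomial v * (monomial u :: ('n, 'k) mpoly)"
    by (simp add: monomial_def mult_single)
  then show ?thesis
    unfolding T using \<open>u \<in> T\<close> by (simp add: ideal.span_scale ideal.span_base)
qed

text \<open>Summing over a common finite superset of the supports makes linearity a termwise
  computation, even when keys cancel.\<close>

lemma distraction_eq_sum:
  assumes "finite A" "Poly_Mapping.keys p \<subseteq> A"
  shows "distraction L p = (\<Sum>t\<in>A. kscale (Poly_Mapping.lookup p t) (distract_pp L t))"
  unfolding distraction_def
  using assms by (intro sum.mono_neutral_left) (auto simp: in_keys_iff)

lemma distraction_add: "distraction L (p + q) = distraction L p + distraction L q"
proof -
  let ?A = "Poly_Mapping.keys p \<union> Poly_Mapping.keys q"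
  have "finite ?A" by simp
  then show ?thesis
    using keys_add[of p q]
    by (simp add: distraction_eq_sum[of ?A] lookup_add kspace.scale_left_distrib sum.distrib)
qed

lemma distraction_kscale: "distraction L (kscale c p) = kscale c (distraction L p)"
proof -
  have "Poly_Mapping.keys (kscale c p) \<subseteq> Poly_Mapping.keys p"
    by (auto simp: in_keys_iff lookup_kscale)
  then show ?thesis
    by (simp add: distraction_eq_sum[of "Poly_Mapping.keys p"] lookup_kscale
        kspace.scale_sum_right)
qed

lemma distraction_monomial: "distraction L (monomial t) = distract_pp L t"
  by (simp add: distraction_def monomial_def)

lemma span_distract_pp_subset:
  assumes "monomial_ideal I"
  shows "kspace.span (distract_pp L ` {s. monomial s \<in> I}) \<subseteq> distraction L ` I"
proof (rule kspace.span_minimal)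
  show "distract_pp L ` {s. monomial s \<in> I} \<subseteq> distraction L ` I"
    using distraction_monomial[of L] by (metis (mono_tags, lifting) image_subset_iff imageI mem_Collect_eq)
  obtain T where T: "I = ideal.span (monomial ` T)"
    using assms unfolding monomial_ideal_def by blast
  show "kspace.subspace (distraction L ` I)"
  proof (rule kspace.subspaceI)
    have "distraction L 0 = 0" by (simp add: distraction_def)
    then show "0 \<in> distraction L ` I" unfolding T by (metis ideal.span_zero imageI)
  next
    fix x y assume "x \<in> distraction L ` I" "y \<in> distraction L ` I"
    then show "x + y \<in> distraction L ` I"
      unfolding T by (auto simp flip: distraction_add intro!: imageI ideal.span_add)
  next
    fix c x assume "x \<in> distraction L ` I"
    then show "kscale c x \<in> distraction L ` I"
      unfolding T by (auto simp flip: distraction_kscale intro!: imageI kscale_in_ideal)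
  qed
qed

text \<open>Otherwise \<open>distraction L p\<close> would extend the polynomials with leading terms
  in \<open>M\<close> to \<open>card M + 1\<close> independent elements of a space spanned by at
  most \<open>card M\<close> elements.\<close>

lemma leading_pp_of_distraction:
  fixes L :: "'n::{finite,linorder} \<Rightarrow> nat \<Rightarrow> ('n, 'k::field) mpoly"
  assumes L: "distraction_matrix L" "sufficiently_generic L" and I: "strongly_stable I"
    and p: "p \<in> I" and t: "is_leading_pp (distraction L p) t"
  shows "monomial t \<in> I"
proof (rule ccontr)
  assume t_notin: "monomial t \<notin> I"
  have "monomial_ideal I" using I by (simp add: strongly_stable_def)
  obtain F where F: "\<And>s. F s \<in> kspace.span (distract_pp L ` borel_above I s)"
      "\<And>s. is_leading_pp (F s) s"
    using borel_above_leading[OF L I] by metis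
  \<comment> \<open>The degree bound keeps \<open>M\<close> finite while still including every key
    of \<open>p\<close>.\<close>
  define e where "e = Max (deg_pp ` Poly_Mapping.keys p)"
  define M where "M = {s. monomial s \<in> I \<and> deg_pp s \<le> e}"
  have "finite M"
    by (rule finite_subset[OF _ finite_deg_pp_le[of e]]) (auto simp: M_def)
  have "t \<notin> M" using t_notin by (simp add: M_def)
  define G where "G = F(t := distraction L p)"
  have lead: "is_leading_pp (G s) s" for s using F(2) t by (simp add: G_def)
  have "borel_above I s \<subseteq> M" if "s \<in> M" for s
  proof
    fix r assume "r \<in> borel_above I s"
    then have "deg_pp r = deg_pp s" "monomial (s + 0) \<in> I \<longrightarrow> monomial (r + 0) \<in> I"
      unfolding borel_above_def by blast+
    then show "r \<in> M" using that by (simp add: M_def)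
  qed
  then have "F s \<in> kspace.span (distract_pp L ` M)" if "s \<in> M" for s
    using F(1)[of s] that by (meson image_mono kspace.span_mono subsetD)
  moreover have "Poly_Mapping.keys p \<subseteq> M"
    using monomial_in_monomial_ideal[OF \<open>monomial_ideal I\<close> p] by (auto simp: M_def e_def)
  then have "distraction L p \<in> kspace.span (distract_pp L ` M)"
    unfolding distraction_def
    by (intro kspace.span_sum kspace.span_scale kspace.span_base) auto
  ultimately have sub: "G ` insert t M \<subseteq> kspace.span (distract_pp L ` M)"
    by (auto simp: G_def)
  have fin: "finite (insert t M)" using \<open>finite M\<close> by simp
  have "Suc (card M) = card (G ` insert t M)"
    using card_image[OF independent_if_leading(1)[OF fin lead]] \<open>finite M\<close> \<open>t \<notin> M\<close> by simp
  also have "\<dots> \<le> card (distract_pp L ` M)"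
    using kspace.independent_span_bound[OF _ independent_if_leading(2)[OF fin lead] sub]
      \<open>finite M\<close> by simp
  also have "\<dots> \<le> card M" by (rule card_image_le) fact
  finally show False by simp
qed

theorem theorem4p2:
  fixes L :: "'n::{finite,linorder} \<Rightarrow> nat \<Rightarrow> ('n, 'k::field) mpoly"
    and I :: "('n, 'k) mpoly set"
  assumes "infinite (UNIV :: 'k set)"
    and "distraction_matrix L"
    and "sufficiently_generic L"
    and "strongly_stable I"
  shows "in_drl (distraction L ` I) = I"
proof -
  have mono: "monomial_ideal I" using assms(4) by (simp add: strongly_stable_def)
  then obtain T where T: "I = ideal.span (monomial ` T)"
    unfolding monomial_ideal_def by blast
  have "(\<exists>f\<in>distraction L ` I. is_leading_pp f t) \<longleftrightarrow> monomial t \<in> I" for t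
  proof
    show "monomial t \<in> I" if "\<exists>f\<in>distraction L ` I. is_leading_pp f t"
      using that leading_pp_of_distraction[OF assms(2-4)] by blast
  next
    assume t: "monomial t \<in> I"
    \<comment> \<open>The trivial translate \<open>r = 0\<close> in \<open>borel_above\<close> turns
      membership of \<open>t\<close> in \<open>I\<close> into membership of
      \<open>s\<close>.\<close>
    have "monomial (s + 0) \<in> I" if "s \<in> borel_above I t" for s
      using that t unfolding borel_above_def by (metis (mono_tags, lifting) add.right_neutral mem_Collect_eq)
    then have "kspace.span (distract_pp L ` borel_above I t) \<subseteq> distraction L ` I"
      by (intro order_trans[OF kspace.span_mono span_distract_pp_subset[OF mono]]) auto
    then show "\<exists>f\<in>distraction L ` I. is_leading_pp f t"
      using borel_above_leading[OF assms(2-4), of t] by blast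
  qed
  then have "in_drl (distraction L ` I) = ideal.span {monomial t | t. monomial t \<in> I}"
    by (simp add: in_drl_def)
  also have "\<dots> = I"
  proof
    show "ideal.span {monomial t | t. monomial t \<in> I} \<subseteq> I"
      by (rule ideal.span_minimal) (auto simp: T)
    show "I \<subseteq> ideal.span {monomial t | t. monomial t \<in> I}"
      by (subst T, rule ideal.span_mono) (auto simp: T intro: ideal.span_base)
  qed
  finally show ?thesis .
qed

end
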